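(* Let $A=A(a,b,c)$ be a planar robot $3$-arm with $a,b,c>0$, and let $M(A)$ be its planar moduli space with coordinates $(\phi,\eta)$. The Jacobian determinant of $R^{-1}=1/R:M(A)\to\mathbb{C}$ with respect to $(\phi,\eta)$ is equal, up to a non-zero constant factor depending only on $a,b,c$, to the signed area of the quadrangle defined by the arm. The critical points of $R$ and of the cross-ratio map $Cr$ are exactly the arm configurations with signed area equal to zero.
   Context: A planar robot $3$-arm $A=A(a,b,c)$ is given by positive reals $a,b,c$. A configuration is a quadruple $V=(v_1,v_2,v_3,v_4)\in\mathbb{C}^4$ with $|v_2-v_1|=a$, $|v_3-v_2|=b$, $|v_4-v_3|=c$; the moduli space $M(A)$ is the set of configurations modulo orientation-preserving isometries of $\mathbb{C}$. It is a 2-torus with angular coordinates $(\phi,\eta)$, where $(\phi,\eta)$ represents the configuration $(0,\,a,\,a+be^{i\phi},\,a+be^{i\phi}+ce^{i\eta})$. The maps $R,Cr:M(A)\to\mathbb{P}^1(\mathbb{C})$ are $$R(V)=\frac{(v_2-v_1)(v_4-v_3)}{(v_2-v_3)(v_4-v_1)},\qquad Cr(V)=\frac{(v_3-v_1)(v_4-v_2)}{(v_3-v_2)(v_4-v_1)}=1-R(V),$$ with value $\infty$ iff $v_1=v_4$; $R$ never vanishes, so $R^{-1}$ takes values in $\mathbb{C}\cong\mathbb{R}^2$. The signed area of the quadrangle with vertices $v_j=x_j+iy_j$ in this order is $\frac12\sum_{j=1}^4(x_jy_{j+1}-x_{j+1}y_j)$, indices mod 4. *)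

theory Defs
  imports "HOL-Analysis.Analysis"
begin

section \<open>The complex projective line\<close>

datatype cp1 = Fin complex | Infty

fun affine_chart :: "cp1 \<Rightarrow> complex" where
  "affine_chart (Fin z) = z"
| "affine_chart Infty = 0" (* junk value: \<open>Infty\<close> lies outside the domain of this chart *)

text \<open>The value of \<open>1/w\<close>, as a complex number; a chart on the complement of \<open>0\<close>
  (at \<open>Fin 0\<close> it has a junk value).\<close>

fun infinity_chart :: "cp1 \<Rightarrow> complex" where
  "infinity_chart (Fin z) = inverse z"
| "infinity_chart Infty = 0"

definition cp1_charts :: "(cp1 set \<times> (cp1 \<Rightarrow> complex)) set" where
  "cp1_charts = {(- {Infty}, affine_chart), (- {Fin 0}, infinity_chart)}"


section \<open>Planar robot 3-arms and their moduli space\<close>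

definition configurations :: "real \<Rightarrow> real \<Rightarrow> real \<Rightarrow> (complex ^ 4) set" where
  "configurations a b c =
     {V. norm (V $ 2 - V $ 1) = a \<and> norm (V $ 3 - V $ 2) = b \<and> norm (V $ 4 - V $ 3) = c}"

text \<open>The orientation-preserving isometries of the plane are the maps
  \<open>z \<mapsto> u * z + w\<close> with \<open>norm u = 1\<close>.\<close>

definition congruence :: "real \<Rightarrow> real \<Rightarrow> real \<Rightarrow> ((complex ^ 4) \<times> (complex ^ 4)) set" where
  "congruence a b c =
     {(V, W). V \<in> configurations a b c \<and> W \<in> configurations a b c \<and>
              (\<exists>u w. norm u = 1 \<and> (\<forall>j. W $ j = u * V $ j + w))}"

definition moduli :: "real \<Rightarrow> real \<Rightarrow> real \<Rightarrow> (complex ^ 4) set set" where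
  "moduli a b c = configurations a b c // congruence a b c"

text \<open>The coordinates \<open>(\<phi>, \<eta>)\<close> are the two components of \<open>p\<close>; they are angles, i.e. only
  determined modulo \<open>2 * pi\<close> by the point of the moduli space (see \<open>arm_point_eq_iff\<close> below).\<close>

definition arm_configuration :: "real \<Rightarrow> real \<Rightarrow> real \<Rightarrow> real ^ 2 \<Rightarrow> complex ^ 4" where
  "arm_configuration a b c p = (\<chi> j.
     if j = 1 then 0
     else if j = 2 then of_real a
     else if j = 3 then of_real a + of_real b * cis (p $ 1)
     else of_real a + of_real b * cis (p $ 1) + of_real c * cis (p $ 2))"

definition arm_point :: "real \<Rightarrow> real \<Rightarrow> real \<Rightarrow> real ^ 2 \<Rightarrow> (complex ^ 4) set" where
  "arm_point a b c p = congruence a b c `` {arm_configuration a b c p}"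


section \<open>The maps and the signed area\<close>

definition R_conf :: "complex ^ 4 \<Rightarrow> cp1" where
  "R_conf V = (if V $ 1 = V $ 4 then Infty
     else Fin (((V $ 2 - V $ 1) * (V $ 4 - V $ 3)) / ((V $ 2 - V $ 3) * (V $ 4 - V $ 1))))"

definition Cr_conf :: "complex ^ 4 \<Rightarrow> cp1" where
  "Cr_conf V = (if V $ 1 = V $ 4 then Infty
     else Fin (((V $ 3 - V $ 1) * (V $ 4 - V $ 2)) / ((V $ 3 - V $ 2) * (V $ 4 - V $ 1))))"

text \<open>The index type \<open>4\<close> is the integers modulo 4, so \<open>j + 1\<close> is cyclic.\<close>

definition signed_area_conf :: "complex ^ 4 \<Rightarrow> real" where
  "signed_area_conf V =
     (\<Sum>j\<in>UNIV. Re (V $ j) * Im (V $ (j + 1)) - Re (V $ (j + 1)) * Im (V $ j)) / 2"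

text \<open>These functions are constant on each congruence class (lemmas \<open>R_conf_congruence\<close>,
  \<open>Cr_conf_congruence\<close>, \<open>signed_area_conf_congruence\<close> below), so they descend to the moduli
  space.\<close>

definition R :: "(complex ^ 4) set \<Rightarrow> cp1" where
  "R X = the_elem (R_conf ` X)"

definition Cr :: "(complex ^ 4) set \<Rightarrow> cp1" where
  "Cr X = the_elem (Cr_conf ` X)"

definition signed_area :: "(complex ^ 4) set \<Rightarrow> real" where
  "signed_area X = the_elem (signed_area_conf ` X)"

definition R_inverse :: "(complex ^ 4) set \<Rightarrow> complex" where
  "R_inverse X = infinity_chart (R X)"


section \<open>Jacobian and critical points\<close>

definition complex_to_R2 :: "complex \<Rightarrow> real ^ 2" where
  "complex_to_R2 z = vector [Re z, Im z]"

definition R_inverse_coord :: "real \<Rightarrow> real \<Rightarrow> real \<Rightarrow> real ^ 2 \<Rightarrow> real ^ 2" where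
  "R_inverse_coord a b c p = complex_to_R2 (R_inverse (arm_point a b c p))"

text \<open>\<open>D\<close> is the differential at the point with coordinates \<open>p\<close> of a map \<open>f\<close> from the moduli
  space to the projective line, expressed in the angular coordinates on the source and in some
  chart on the target.\<close>

definition has_differential ::
  "real \<Rightarrow> real \<Rightarrow> real \<Rightarrow> ((complex ^ 4) set \<Rightarrow> cp1) \<Rightarrow> real ^ 2 \<Rightarrow> (real ^ 2 \<Rightarrow> complex) \<Rightarrow> bool"
where
  "has_differential a b c f p D \<longleftrightarrow>
     (\<exists>(U, \<psi>) \<in> cp1_charts.
        (\<forall>\<^sub>F q in nhds p. f (arm_point a b c q) \<in> U) \<and>
        ((\<lambda>q. \<psi> (f (arm_point a b c q))) has_derivative D) (at p))"

text \<open>A critical point is a point where the differential is not surjective. Both \<open>R\<close> and \<open>Cr\<close>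
  have a differential at every point (lemmas \<open>R_has_differential\<close> and \<open>Cr_has_differential\<close>).\<close>

definition critical_points ::
  "real \<Rightarrow> real \<Rightarrow> real \<Rightarrow> ((complex ^ 4) set \<Rightarrow> cp1) \<Rightarrow> (complex ^ 4) set set" where
  "critical_points a b c f =
     {X \<in> moduli a b c.
        \<exists>p D. X = arm_point a b c p \<and> has_differential a b c f p D \<and> \<not> surj D}"


section \<open>Well-definedness\<close>

lemma add_one_4: "(1::4) + 1 = 2" "(2::4) + 1 = 3" "(3::4) + 1 = 4" "(4::4) + 1 = 1"
  by simp_all

lemma arm_configuration_nth:
  "arm_configuration a b c p $ 1 = 0"
  "arm_configuration a b c p $ 2 = of_real a"
  "arm_configuration a b c p $ 3 = of_real a + of_real b * cis (p $ 1)"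
  "arm_configuration a b c p $ 4 = of_real a + of_real b * cis (p $ 1) + of_real c * cis (p $ 2)"
  by (simp_all add: arm_configuration_def)

lemma arm_configuration_in:
  assumes "a > 0" "b > 0" "c > 0"
  shows "arm_configuration a b c p \<in> configurations a b c"
  using assms by (simp add: configurations_def arm_configuration_nth norm_mult)

lemma equiv_congruence: "equiv (configurations a b c) (congruence a b c)"
proof (rule equivI)
  show "congruence a b c \<subseteq> configurations a b c \<times> configurations a b c"
    by (auto simp: congruence_def)
  show "refl_on (configurations a b c) (congruence a b c)"
  proof (rule refl_onI)
    fix V assume "V \<in> configurations a b c"
    moreover have "norm (1::complex) = 1 \<and> (\<forall>j. V $ j = 1 * V $ j + 0)" by simp
    ultimately show "(V, V) \<in> congruence a b c" unfolding congruence_def by blast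
  qed
  show "sym (congruence a b c)"
  proof (rule symI)
    fix V W assume "(V, W) \<in> congruence a b c"
    then obtain u w where *: "V \<in> configurations a b c" "W \<in> configurations a b c" "norm u = 1"
      "\<And>j. W $ j = u * V $ j + w" by (auto simp: congruence_def)
    then have "u \<noteq> 0" by auto
    then have "V $ j = inverse u * W $ j + (- inverse u * w)" for j
      using *(4)[of j] by (simp add: field_simps)
    moreover have "norm (inverse u) = 1" using *(3) by (simp add: norm_inverse)
    ultimately show "(W, V) \<in> congruence a b c" using * unfolding congruence_def by blast
  qed
  show "trans (congruence a b c)"
  proof (rule transI)
    fix V W Z assume "(V, W) \<in> congruence a b c" "(W, Z) \<in> congruence a b c"
    then obtain u w u' w' where *: "V \<in> configurations a b c" "Z \<in> configurations a b c"
      "norm u = 1" "norm u' = 1" "\<And>j. W $ j = u * V $ j + w" "\<And>j. Z $ j = u' * W $ j + w'"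
      by (auto simp: congruence_def)
    then have "Z $ j = (u' * u) * V $ j + (u' * w + w')" for j
      by (simp add: algebra_simps)
    moreover have "norm (u' * u) = 1" using * by (simp add: norm_mult)
    ultimately show "(V, Z) \<in> congruence a b c" using * unfolding congruence_def by blast
  qed
qed

lemma R_conf_congruence:
  assumes "(V, W) \<in> congruence a b c"
  shows "R_conf W = R_conf V"
proof -
  obtain u w where u: "norm u = 1" and W: "\<And>j. W $ j = u * V $ j + w"
    using assms by (auto simp: congruence_def)
  have "u \<noteq> 0" using u by auto
  moreover have "W $ i - W $ j = u * (V $ i - V $ j)" for i j
    by (simp add: W algebra_simps)
  ultimately show ?thesis by (simp add: R_conf_def W)
qed

lemma Cr_conf_congruence:
  assumes "(V, W) \<in> congruence a b c"
  shows "Cr_conf W = Cr_conf V"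
proof -
  obtain u w where u: "norm u = 1" and W: "\<And>j. W $ j = u * V $ j + w"
    using assms by (auto simp: congruence_def)
  have "u \<noteq> 0" using u by auto
  moreover have "W $ i - W $ j = u * (V $ i - V $ j)" for i j
    by (simp add: W algebra_simps)
  ultimately show ?thesis by (simp add: Cr_conf_def W)
qed

lemma signed_area_conf_alt:
  "signed_area_conf V =
     (Im (cnj (V $ 2 - V $ 1) * (V $ 3 - V $ 1)) + Im (cnj (V $ 3 - V $ 1) * (V $ 4 - V $ 1))) / 2"
  unfolding signed_area_conf_def sum_4 add_one_4 by (simp add: algebra_simps)

lemma signed_area_conf_congruence:
  assumes "(V, W) \<in> congruence a b c"
  shows "signed_area_conf W = signed_area_conf V"
proof -
  obtain u w where u: "norm u = 1" and W: "\<And>j. W $ j = u * V $ j + w"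
    using assms by (auto simp: congruence_def)
  have "cnj u * u = 1" using u by (metis complex_norm_square mult.commute of_real_1 power_one)
  then have "cnj (u * x) * (u * y) = cnj x * y" for x y
    by (metis (no_types, lifting) complex_cnj_mult mult.assoc mult.left_commute mult_1)
  moreover have "W $ i - W $ j = u * (V $ i - V $ j)" for i j
    by (simp add: W algebra_simps)
  ultimately show ?thesis by (simp only: signed_area_conf_alt)
qed

lemma the_elem_class:
  assumes "\<And>V W. (V, W) \<in> congruence a b c \<Longrightarrow> f W = f V" and "V \<in> configurations a b c"
  shows "the_elem (f ` (congruence a b c `` {V})) = f V"
proof -
  have "V \<in> congruence a b c `` {V}"
    using equiv_class_self[OF equiv_congruence assms(2)] .
  moreover have "f W = f V" if "W \<in> congruence a b c `` {V}" for W
    using that assms(1) by auto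
  ultimately have "f ` (congruence a b c `` {V}) = {f V}" by blast
  then show ?thesis by simp
qed

lemma
  assumes "V \<in> configurations a b c"
  shows R_class: "R (congruence a b c `` {V}) = R_conf V"
    and Cr_class: "Cr (congruence a b c `` {V}) = Cr_conf V"
    and signed_area_class: "signed_area (congruence a b c `` {V}) = signed_area_conf V"
  unfolding R_def Cr_def signed_area_def
  by (rule the_elem_class[OF _ assms], erule R_conf_congruence Cr_conf_congruence
        signed_area_conf_congruence)+

lemma moduli_eq_range_arm_point:
  assumes "a > 0" "b > 0" "c > 0"
  shows "moduli a b c = range (arm_point a b c)"
proof
  show "range (arm_point a b c) \<subseteq> moduli a b c"
    using arm_configuration_in[OF assms] by (auto simp: moduli_def arm_point_def intro!: quotientI)
  show "moduli a b c \<subseteq> range (arm_point a b c)"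
  proof
    fix X assume "X \<in> moduli a b c"
    then obtain V where V: "V \<in> configurations a b c" and X: "X = congruence a b c `` {V}"
      by (auto simp: moduli_def elim: quotientE)
    define s where "s = Arg (V $ 2 - V $ 1)"
    define p :: "real ^ 2"
      where "p = vector [Arg (V $ 3 - V $ 2) - s, Arg (V $ 4 - V $ 3) - s]"
    have polar: "z = of_real (norm z) * cis (Arg z)" for z
      by (metis rcis_cmod_Arg rcis_def)
    have d: "V $ 2 - V $ 1 = of_real a * cis s"
      "V $ 3 - V $ 2 = of_real b * (cis (p $ 1) * cis s)"
      "V $ 4 - V $ 3 = of_real c * (cis (p $ 2) * cis s)"
      using V polar[of "V $ 2 - V $ 1"] polar[of "V $ 3 - V $ 2"] polar[of "V $ 4 - V $ 3"]
      by (simp_all add: configurations_def s_def p_def cis_mult)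
    have "V $ 2 = V $ 1 + of_real a * cis s" using d(1) by (simp add: algebra_simps)
    moreover have "V $ 3 = V $ 2 + of_real b * (cis (p $ 1) * cis s)"
      using d(2) by (simp add: algebra_simps)
    moreover have "V $ 4 = V $ 3 + of_real c * (cis (p $ 2) * cis s)"
      using d(3) by (simp add: algebra_simps)
    ultimately have "\<forall>j. V $ j = cis s * arm_configuration a b c p $ j + V $ 1"
      unfolding forall_4 arm_configuration_nth by (simp add: algebra_simps)
    then have "(arm_configuration a b c p, V) \<in> congruence a b c"
      using V arm_configuration_in[OF assms, of p] norm_cis[of s]
      unfolding congruence_def by blast
    then have "X = arm_point a b c p"
      unfolding X arm_point_def by (metis equiv_class_eq equiv_congruence)
    then show "X \<in> range (arm_point a b c)" by blast
  qed
qed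

lemma arm_point_eq_iff:
  assumes "a > 0" "b > 0" "c > 0"
  shows "arm_point a b c p = arm_point a b c q \<longleftrightarrow>
    (\<forall>i. \<exists>n::int. p $ i - q $ i = 2 * pi * of_int n)"
proof -
  have cis_eq: "cis x = cis y \<longleftrightarrow> (\<exists>n::int. x - y = 2 * pi * of_int n)" for x y
  proof -
    have "cis x = cis y \<longleftrightarrow> cis (x - y) = 1"
      by (simp add: cis_divide[symmetric])
    also have "\<dots> \<longleftrightarrow> cos (x - y) = 1"
      using cos_one_sin_zero[of "x - y"] by (auto simp: complex_eq_iff)
    also have "\<dots> \<longleftrightarrow> (\<exists>n::int. x - y = 2 * pi * of_int n)"
      by (simp add: cos_one_2pi_int mult_ac)
    finally show ?thesis .
  qed
  have "arm_point a b c p = arm_point a b c q \<longleftrightarrow>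
      (arm_configuration a b c p, arm_configuration a b c q) \<in> congruence a b c"
    unfolding arm_point_def
    by (rule eq_equiv_class_iff[OF equiv_congruence]) (rule arm_configuration_in[OF assms])+
  also have "\<dots> \<longleftrightarrow> cis (p $ 1) = cis (q $ 1) \<and> cis (p $ 2) = cis (q $ 2)" (is "?l \<longleftrightarrow> ?r")
  proof
    assume ?l
    then obtain u w where
      "\<forall>j. arm_configuration a b c q $ j = u * arm_configuration a b c p $ j + w"
      by (auto simp: congruence_def)
    then have *: "w = 0" "of_real a = u * of_real a + w"
      "of_real a + of_real b * cis (q $ 1) = u * (of_real a + of_real b * cis (p $ 1)) + w"
      "of_real a + of_real b * cis (q $ 1) + of_real c * cis (q $ 2)
         = u * (of_real a + of_real b * cis (p $ 1) + of_real c * cis (p $ 2)) + w"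
      unfolding forall_4 arm_configuration_nth by auto
    then have "u = 1" using assms by simp
    with * show ?r using assms by simp
  next
    assume ?r
    then have "arm_configuration a b c p = arm_configuration a b c q"
      by (simp add: vec_eq_iff forall_4 arm_configuration_nth)
    then show ?l
      using equiv_class_self[OF equiv_congruence arm_configuration_in[OF assms, of p]] by simp
  qed
  finally show ?thesis by (simp add: cis_eq forall_2)
qed

lemma configurations_neq:
  assumes "a > 0" "b > 0" "c > 0" "V \<in> configurations a b c"
  shows "V $ 2 \<noteq> V $ 1" "V $ 3 \<noteq> V $ 2" "V $ 4 \<noteq> V $ 3"
  using assms by (auto simp: configurations_def)

lemma R_conf_nonzero:
  assumes "a > 0" "b > 0" "c > 0" "V \<in> configurations a b c"
  shows "R_conf V \<noteq> Fin 0"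
  using configurations_neq[OF assms] by (simp add: R_conf_def)

lemma infinity_chart_R_conf:
  assumes "a > 0" "b > 0" "c > 0" "V \<in> configurations a b c"
  shows "infinity_chart (R_conf V) =
    ((V $ 2 - V $ 3) * (V $ 4 - V $ 1)) / ((V $ 2 - V $ 1) * (V $ 4 - V $ 3))"
  using configurations_neq[OF assms] by (simp add: R_conf_def)

lemma Cr_conf_eq:
  assumes "a > 0" "b > 0" "c > 0" "V \<in> configurations a b c"
  shows "Cr_conf V = (case R_conf V of Fin z \<Rightarrow> Fin (1 - z) | Infty \<Rightarrow> Infty)"
  using configurations_neq[OF assms] by (auto simp: R_conf_def Cr_conf_def divide_simps) (simp add: algebra_simps)

lemma has_differential_affine:
  assumes "isCont g p" "h differentiable (at p)" "g p \<noteq> (0::complex)"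
    and "\<And>q. g q \<noteq> 0 \<Longrightarrow> f (arm_point a b c q) = Fin (h q)"
  shows "\<exists>D. has_differential a b c f p D"
proof -
  have ev: "\<forall>\<^sub>F q in nhds p. g q \<noteq> 0"
    using assms(1,3) by (simp add: isCont_def tendsto_imp_eventually_ne eventually_nhds_conv_at)
  obtain D where "(h has_derivative D) (at p)" using assms(2) by (auto simp: differentiable_def)
  moreover have "\<forall>\<^sub>F q in nhds p. h q = affine_chart (f (arm_point a b c q))"
    using ev by eventually_elim (simp add: assms(4))
  ultimately have "((\<lambda>q. affine_chart (f (arm_point a b c q))) has_derivative D) (at p)"
    by (auto simp: eventually_nhds_conv_at intro: has_derivative_transform_eventually)
  moreover have "\<forall>\<^sub>F q in nhds p. f (arm_point a b c q) \<in> - {Infty}"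
    using ev by eventually_elim (simp add: assms(4))
  ultimately show ?thesis unfolding has_differential_def cp1_charts_def by blast
qed

lemma has_differential_infinity:
  assumes "isCont g p" "h differentiable (at p)" "g p \<noteq> (0::complex)"
    and "\<And>q. g q \<noteq> 0 \<Longrightarrow> f (arm_point a b c q) \<noteq> Fin 0 \<and> infinity_chart (f (arm_point a b c q)) = h q"
  shows "\<exists>D. has_differential a b c f p D"
proof -
  have ev: "\<forall>\<^sub>F q in nhds p. g q \<noteq> 0"
    using assms(1,3) by (simp add: isCont_def tendsto_imp_eventually_ne eventually_nhds_conv_at)
  obtain D where "(h has_derivative D) (at p)" using assms(2) by (auto simp: differentiable_def)
  moreover have "\<forall>\<^sub>F q in nhds p. h q = infinity_chart (f (arm_point a b c q))"
    using ev by eventually_elim (simp add: assms(4))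
  ultimately have "((\<lambda>q. infinity_chart (f (arm_point a b c q))) has_derivative D) (at p)"
    by (auto simp: eventually_nhds_conv_at intro: has_derivative_transform_eventually)
  moreover have "\<forall>\<^sub>F q in nhds p. f (arm_point a b c q) \<in> - {Fin 0}"
    using ev by eventually_elim (simp add: assms(4))
  ultimately show ?thesis unfolding has_differential_def cp1_charts_def by blast
qed

lemma arm_configuration_differentiable:
  "(\<lambda>q. arm_configuration a b c q $ j) differentiable (at p)"
proof -
  have nth: "(\<lambda>q::real^2. q $ i) differentiable (at p)" for i
    by (simp add: bounded_linear_imp_differentiable bounded_linear_vec_nth)
  have "(\<lambda>q::real^2. cis (q $ i)) differentiable (at p)" for i
  proof -
    have "cos differentiable (at (p $ i))" "sin differentiable (at (p $ i))"
      using DERIV_cos[of "p $ i"] DERIV_sin[of "p $ i"] real_differentiable_def by blast+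
    then have "(\<lambda>q::real^2. cos (q $ i)) differentiable (at p)"
      "(\<lambda>q::real^2. sin (q $ i)) differentiable (at p)"
      by (simp_all add: differentiable_compose[where f = cos, OF _ nth]
            differentiable_compose[where f = sin, OF _ nth])
    then have "(\<lambda>q::real^2. of_real (cos (q $ i)) + \<i> * of_real (sin (q $ i))) differentiable (at p)"
      by (intro differentiable_add differentiable_mult differentiable_const
            differentiable_compose[where f = of_real, OF of_real_differentiable])
    moreover have "cis x = of_real (cos x) + \<i> * of_real (sin x)" for x
      by (simp add: complex_eq_iff)
    ultimately show ?thesis by simp
  qed
  then have "\<forall>j. (\<lambda>q. arm_configuration a b c q $ j) differentiable (at p)"
    unfolding forall_4 arm_configuration_nth
    by (auto intro!: differentiable_add differentiable_mult)
  then show ?thesis by blast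
qed

lemma R_has_differential:
  assumes "a > 0" "b > 0" "c > 0"
  shows "\<exists>D. has_differential a b c R p D"
proof (rule has_differential_infinity[where g = "\<lambda>_. 1"])
  let ?V = "arm_configuration a b c"
  note V = arm_configuration_in[OF assms]
  show "(\<lambda>q. ((?V q $ 2 - ?V q $ 3) * (?V q $ 4 - ?V q $ 1)) /
      ((?V q $ 2 - ?V q $ 1) * (?V q $ 4 - ?V q $ 3))) differentiable (at p)"
    using configurations_neq[OF assms V[of p]]
    by (intro differentiable_divide differentiable_mult differentiable_diff
          arm_configuration_differentiable) simp
  show "R (arm_point a b c q) \<noteq> Fin 0 \<and> infinity_chart (R (arm_point a b c q)) =
      ((?V q $ 2 - ?V q $ 3) * (?V q $ 4 - ?V q $ 1)) /
      ((?V q $ 2 - ?V q $ 1) * (?V q $ 4 - ?V q $ 3))" for q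
    using R_conf_nonzero[OF assms V] infinity_chart_R_conf[OF assms V]
    by (simp add: arm_point_def R_class[OF V])
qed auto

lemma Cr_has_differential:
  assumes "a > 0" "b > 0" "c > 0"
  shows "\<exists>D. has_differential a b c Cr p D"
proof -
  let ?V = "arm_configuration a b c"
  note V = arm_configuration_in[OF assms]
  note neq = configurations_neq[OF assms V]
  note diff = differentiable_divide differentiable_mult differentiable_diff
    arm_configuration_differentiable
  show ?thesis
  proof (cases "?V p $ 1 = ?V p $ 4")
    case False
    show ?thesis
    proof (rule has_differential_affine[where g = "\<lambda>q. ?V q $ 4 - ?V q $ 1"])
      show "(\<lambda>q. ((?V q $ 3 - ?V q $ 1) * (?V q $ 4 - ?V q $ 2)) /
          ((?V q $ 3 - ?V q $ 2) * (?V q $ 4 - ?V q $ 1))) differentiable (at p)"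
        using neq[of p] False by (intro diff) simp
      show "Cr (arm_point a b c q) = Fin (((?V q $ 3 - ?V q $ 1) * (?V q $ 4 - ?V q $ 2)) /
          ((?V q $ 3 - ?V q $ 2) * (?V q $ 4 - ?V q $ 1)))"
        if "?V q $ 4 - ?V q $ 1 \<noteq> 0" for q
        using that by (auto simp: arm_point_def Cr_class[OF V] Cr_conf_def)
      show "isCont (\<lambda>q. ?V q $ 4 - ?V q $ 1) p"
        by (intro differentiable_imp_continuous_within diff)
    qed (use False in auto)
  next
    case True
    show ?thesis
    proof (rule has_differential_infinity
        [where g = "\<lambda>q. (?V q $ 3 - ?V q $ 1) * (?V q $ 4 - ?V q $ 2)"])
      show nz: "(?V p $ 3 - ?V p $ 1) * (?V p $ 4 - ?V p $ 2) \<noteq> 0"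
        using neq[of p] True by auto
      show "(\<lambda>q. ((?V q $ 3 - ?V q $ 2) * (?V q $ 4 - ?V q $ 1)) /
          ((?V q $ 3 - ?V q $ 1) * (?V q $ 4 - ?V q $ 2))) differentiable (at p)"
        using nz by (intro diff) simp
      show "Cr (arm_point a b c q) \<noteq> Fin 0 \<and> infinity_chart (Cr (arm_point a b c q)) =
          ((?V q $ 3 - ?V q $ 2) * (?V q $ 4 - ?V q $ 1)) /
          ((?V q $ 3 - ?V q $ 1) * (?V q $ 4 - ?V q $ 2))"
        if "(?V q $ 3 - ?V q $ 1) * (?V q $ 4 - ?V q $ 2) \<noteq> 0" for q
        using that neq[of q] by (auto simp: arm_point_def Cr_class[OF V] Cr_conf_def)
      show "isCont (\<lambda>q. (?V q $ 3 - ?V q $ 1) * (?V q $ 4 - ?V q $ 2)) p"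
        by (intro differentiable_imp_continuous_within diff)
    qed
  qed
qed

end

theory Submission
  imports Defs
begin

text \<open>
  Write \<open>u = cis \<phi>\<close>, \<open>w = cis \<eta>\<close>. On the arm with vertices \<open>0, a, a + b u, a + b u + c w\<close> the
  map \<open>1/R\<close> is the trigonometric polynomial \<open>- b u (a + b u + c w) / (a c w)\<close>, so it is smooth on
  the whole torus. Its partial derivatives are \<open>- \<i> b / (a c) * (u/w) * (a + 2 b u + c w)\<close> and
  \<open>\<i> b / (a c) * (u/w) * (a + b u)\<close>. The Jacobian is the signed area of the parallelogram spanned
  by these two vectors. Rotating both by the common factor \<open>w/u\<close> and adding
  the second vector to the first preserves this area and leaves \<open>(b / (a c))\<^sup>2\<close> times the signed area of the
  parallelogram spanned by the diagonals \<open>v\<^sub>3 - v\<^sub>1 = a + b u\<close> and \<open>v\<^sub>4 - v\<^sub>2 = b u + c w\<close>.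
  Twice the signed area of a quadrangle is the signed area of the parallelogram on its diagonals,
  hence the Jacobian is \<open>2 b\<^sup>2 / (a c)\<^sup>2\<close> times the signed area of the arm.

  For the critical points, both \<open>R\<close> and \<open>Cr\<close> are \<open>1/R\<close> followed by a Moebius transformation,
  \<open>z \<mapsto> 1/z\<close> and \<open>z \<mapsto> 1 - 1/z\<close>. Seen in either chart of the projective line this is a
  holomorphic function with non-zero derivative, so it multiplies the differential of \<open>1/R\<close> by a
  non-zero complex number and does not affect surjectivity
  (\<open>surj_differential_iff\<close>, \<open>critical_points_Moebius\<close>). Hence the critical points are the zeros of the Jacobian.
\<close>

section \<open>The coordinate expression of the inverse of R and its Jacobian\<close>

lemma signed_area_conf_diagonals:
  "signed_area_conf V = Im (cnj (V $ 3 - V $ 1) * (V $ 4 - V $ 2)) / 2"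
  unfolding signed_area_conf_alt by (simp add: algebra_simps)

lemma signed_area_arm_point:
  assumes "a > 0" "b > 0" "c > 0"
  shows "signed_area (arm_point a b c p) =
    (a * b * sin (p $ 1) + a * c * sin (p $ 2) + b * c * sin (p $ 2 - p $ 1)) / 2"
  unfolding arm_point_def signed_area_class[OF arm_configuration_in[OF assms]]
    signed_area_conf_diagonals arm_configuration_nth
  by (simp add: sin_diff algebra_simps)

text \<open>Expanding the quotient into exponentials makes the angular derivatives immediate.\<close>

lemma R_inverse_arm_point:
  assumes "a > 0" "b > 0" "c > 0"
  shows "R_inverse (arm_point a b c p) = of_real (- b / (a * c)) *
    (of_real a * cis (p $ 1 - p $ 2) + of_real b * cis (2 * p $ 1 - p $ 2) + of_real c * cis (p $ 1))"
proof -
  note V = arm_configuration_in[OF assms, of p]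
  have 1: "cis (p $ 1 - p $ 2) = cis (p $ 1) / cis (p $ 2)"
    by (simp add: cis_divide)
  have 2: "cis (2 * p $ 1 - p $ 2) = cis (p $ 1) * cis (p $ 1) / cis (p $ 2)"
    by (simp add: cis_divide cis_mult)
  have "R_inverse (arm_point a b c p) = infinity_chart (R_conf (arm_configuration a b c p))"
    by (simp add: R_inverse_def arm_point_def R_class[OF V])
  also have "\<dots> = (- of_real b * cis (p $ 1) * (of_real a + of_real b * cis (p $ 1) + of_real c * cis (p $ 2)))
      / (of_real a * (of_real c * cis (p $ 2)))"
    unfolding infinity_chart_R_conf[OF assms V] arm_configuration_nth by simp
  also have "\<dots> = of_real (- b / (a * c)) *
    (of_real a * cis (p $ 1 - p $ 2) + of_real b * cis (2 * p $ 1 - p $ 2) + of_real c * cis (p $ 1))"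
    unfolding 1 2 using assms by (simp add: field_simps)
  finally show ?thesis .
qed

definition R_inverse_differential :: "real \<Rightarrow> real \<Rightarrow> real \<Rightarrow> real ^ 2 \<Rightarrow> real ^ 2 \<Rightarrow> complex" where
  "R_inverse_differential a b c p h = of_real (- b / (a * c)) * \<i> *
    (of_real (a * (h $ 1 - h $ 2)) * cis (p $ 1 - p $ 2)
     + of_real (b * (2 * h $ 1 - h $ 2)) * cis (2 * p $ 1 - p $ 2)
     + of_real (c * h $ 1) * cis (p $ 1))"

lemma has_derivative_cis:
  assumes "(f has_derivative f') (at p)"
  shows "((\<lambda>q. cis (f q)) has_derivative (\<lambda>h. of_real (f' h) * \<i> * cis (f p))) (at p)"
proof -
  have "((\<lambda>q. exp (\<i> * of_real (f q))) has_derivative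
      (\<lambda>h. exp (\<i> * of_real (f p)) * (\<i> * of_real (f' h)))) (at p)"
    by (rule has_derivative_compose[OF _ DERIV_exp[THEN has_field_derivative_imp_has_derivative]])
       (intro has_derivative_mult_right has_derivative_of_real assms)
  then show ?thesis by (simp add: cis_conv_exp mult_ac)
qed

lemma R_inverse_has_derivative:
  assumes "a > 0" "b > 0" "c > 0"
  shows "((\<lambda>q. R_inverse (arm_point a b c q)) has_derivative R_inverse_differential a b c p) (at p)"
proof -
  have nth: "((\<lambda>q::real^2. q $ i) has_derivative (\<lambda>h. h $ i)) (at p)" for i
    by (rule bounded_linear_imp_has_derivative[OF bounded_linear_vec_nth])
  show ?thesis
    unfolding R_inverse_arm_point[OF assms]
    by (rule has_derivative_eq_rhs,
        (rule has_derivative_mult_right has_derivative_add has_derivative_cis has_derivative_diff nth)+)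
       (simp add: R_inverse_differential_def fun_eq_iff algebra_simps)
qed

lemma complex_to_R2_nth: "complex_to_R2 z $ 1 = Re z" "complex_to_R2 z $ 2 = Im z"
  by (simp_all add: complex_to_R2_def)

lemma bounded_linear_complex_to_R2: "bounded_linear complex_to_R2"
  by (rule linear_conv_bounded_linear[THEN iffD1], rule linearI)
     (simp_all add: vec_eq_iff forall_2 complex_to_R2_nth)

lemma R_inverse_coord_has_derivative:
  assumes "a > 0" "b > 0" "c > 0"
  shows "(R_inverse_coord a b c has_derivative
    (\<lambda>h. complex_to_R2 (R_inverse_differential a b c p h))) (at p)"
  using bounded_linear.has_derivative[OF bounded_linear_complex_to_R2 R_inverse_has_derivative[OF assms]]
  by (simp add: R_inverse_coord_def[abs_def])

lemma jacobian_R_inverse_coord: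
  assumes "a > 0" "b > 0" "c > 0"
  shows "jacobian (R_inverse_coord a b c) (at p) =
    matrix (\<lambda>h. complex_to_R2 (R_inverse_differential a b c p h))"
  unfolding jacobian_def frechet_derivative_at[OF R_inverse_coord_has_derivative[OF assms], symmetric] ..

text \<open>With \<open>x = \<phi> - \<eta>\<close>, the exponentials of \<open>\<phi> - \<eta>\<close>, \<open>2 \<phi> - \<eta>\<close> and \<open>\<phi>\<close> are
  \<open>cis x\<close> times \<open>1\<close>, \<open>cis \<phi>\<close> and \<open>cis \<eta>\<close>. So \<open>cis x\<close> is a common factor of both
  partial derivatives and drops out of the determinant, and what remains is expressed by the edge vectors
  of the arm.\<close>

lemma det_jacobian_R_inverse_coord:
  assumes "a > 0" "b > 0" "c > 0"
  shows "det (jacobian (R_inverse_coord a b c) (at p)) =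
    (2 * b\<^sup>2 / (a * c)\<^sup>2) * signed_area (arm_point a b c p)"
proof -
  define A where "A = R_inverse_differential a b c p (axis 1 1)"
  define B where "B = R_inverse_differential a b c p (axis 2 1)"
  define x where "x = p $ 1 - p $ 2"
  define r where "r = - b / (a * c)"
  have ax: "axis (1::2) (1::real) $ 1 = 1" "axis (1::2) (1::real) $ 2 = 0"
    "axis (2::2) (1::real) $ 1 = 0" "axis (2::2) (1::real) $ 2 = 1"
    by (simp_all add: axis_def)
  have cis2: "cis (2 * p $ 1 - p $ 2) = cis x * cis (p $ 1)"
    and cis1: "cis (p $ 1) = cis x * cis (p $ 2)"
    by (simp_all add: cis_mult x_def)
  define P where "P = of_real a + 2 * of_real b * cis (p $ 1) + of_real c * cis (p $ 2)"
  define Q where "Q = of_real a + of_real b * cis (p $ 1)"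
  have A: "A = of_real r * \<i> * cis x * P"
  proof -
    have "A = of_real r * \<i> *
        (of_real a * cis x + 2 * of_real b * (cis x * cis (p $ 1)) + of_real c * cis (p $ 1))"
      unfolding A_def R_inverse_differential_def ax cis2 x_def[symmetric] r_def[symmetric] by simp
    also have "of_real c * cis (p $ 1) = of_real c * (cis x * cis (p $ 2))"
      by (simp only: cis1)
    finally show ?thesis
      unfolding P_def by (simp add: algebra_simps)
  qed
  have B: "B = - (of_real r * \<i> * cis x * Q)"
    unfolding B_def R_inverse_differential_def ax cis2 x_def[symmetric] r_def[symmetric] Q_def
    by (simp add: algebra_simps)
  have "det (jacobian (R_inverse_coord a b c) (at p)) = Im (cnj A * B)"
    unfolding jacobian_R_inverse_coord[OF assms] det_2 matrix_def
    by (simp add: complex_to_R2_nth A_def B_def)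
  also have "cnj A * B = - of_real (r\<^sup>2) * (cnj P * Q)"
  proof -
    have "cnj (cis x) * cis x = 1"
      by (simp add: cis_cnj cis_mult)
    moreover have "cnj A * B = - of_real (r\<^sup>2) * (cnj P * Q) * (cnj (cis x) * cis x)"
      unfolding A B by (simp add: power2_eq_square algebra_simps)
    ultimately show ?thesis by simp
  qed
  also have "Im (- of_real (r\<^sup>2) * (cnj P * Q)) = r\<^sup>2 * (- Im (cnj P * Q))"
    by (simp add: algebra_simps)
  also have "- Im (cnj P * Q) = 2 * signed_area (arm_point a b c p)"
    unfolding signed_area_arm_point[OF assms] P_def Q_def
    by (simp add: sin_diff algebra_simps)
  finally show ?thesis
    by (simp add: r_def power_divide)
qed

lemma surj_R_inverse_differential_iff:
  assumes "a > 0" "b > 0" "c > 0"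
  shows "surj (R_inverse_differential a b c p) \<longleftrightarrow> signed_area (arm_point a b c p) \<noteq> 0"
proof -
  let ?D = "R_inverse_differential a b c p"
  let ?F = "\<lambda>h. complex_to_R2 (?D h)"
  have lin: "linear ?F"
    using has_derivative_linear[OF R_inverse_coord_has_derivative[OF assms]] .
  have "bij complex_to_R2"
  proof (rule o_bij)
    show "(\<lambda>v. Complex (v $ 1) (v $ 2)) \<circ> complex_to_R2 = id"
      "complex_to_R2 \<circ> (\<lambda>v. Complex (v $ 1) (v $ 2)) = id"
      by (auto simp: fun_eq_iff vec_eq_iff forall_2 complex_to_R2_nth)
  qed
  then have "surj ?D \<longleftrightarrow> surj ?F"
    by (metis bij_is_inj bij_is_surj comp_surj image_image inj_image_eq_iff o_def)
  also have "\<dots> \<longleftrightarrow> inj ?F"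
    using lin linear_injective_imp_surjective linear_surjective_imp_injective by blast
  also have "\<dots> \<longleftrightarrow> det (matrix ?F) \<noteq> 0"
    using det_nz_iff_inj[OF lin] by simp
  also have "\<dots> \<longleftrightarrow> signed_area (arm_point a b c p) \<noteq> 0"
    using det_jacobian_R_inverse_coord[OF assms, of p] assms
    unfolding jacobian_R_inverse_coord[OF assms] by simp
  finally show ?thesis .
qed


section \<open>Critical points of Moebius transforms of the inverse of R\<close>

text \<open>Multiplication by the derivative \<open>d\<close> of the chart expression \<open>m\<close> of a conformal map is an
  automorphism of the plane.\<close>

lemma surj_differential_iff:
  fixes g :: "'a::real_normed_vector \<Rightarrow> complex"
  assumes g: "(g has_derivative G) (at p)"
    and m: "(m has_field_derivative d) (at (g p))" "d \<noteq> 0"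
    and h: "(h has_derivative D) (at p)" "\<forall>\<^sub>F q in nhds p. h q = m (g q)"
  shows "surj D \<longleftrightarrow> surj G"
proof -
  have "((\<lambda>q. m (g q)) has_derivative (\<lambda>v. d * G v)) (at p)"
    using has_derivative_compose[OF g has_field_derivative_imp_has_derivative[OF m(1)]] .
  moreover have "((\<lambda>q. m (g q)) has_derivative D) (at p)"
    using h eventually_nhds_x_imp_x[OF h(2)]
    by (auto simp: eventually_nhds_conv_at intro: has_derivative_transform_eventually)
  ultimately have D: "D = (\<lambda>v. d * G v)"
    by (rule has_derivative_unique[symmetric])
  show ?thesis
  proof
    assume "surj D"
    show "surj G"
    proof (unfold surj_def, rule allI)
      fix y
      obtain v where "d * y = D v" using \<open>surj D\<close> by (metis surjD)
      then show "\<exists>v. y = G v" using D m(2) by (auto intro: exI[of _ v])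
    qed
  next
    assume "surj G"
    show "surj D"
    proof (unfold surj_def, rule allI)
      fix y
      obtain v where "y / d = G v" using \<open>surj G\<close> by (metis surjD)
      then show "\<exists>v. y = D v" using D m(2) by (auto simp: field_simps)
    qed
  qed
qed

text \<open>In the chart at infinity the map \<open>w \<mapsto> e + s / w\<close> is \<open>w / (e w + s)\<close>, which
  remains holomorphic at \<open>w = 0\<close>.\<close>

lemma critical_points_Moebius:
  fixes e s :: complex
  assumes pos: "a > 0" "b > 0" "c > 0" and s: "s \<noteq> 0"
    and f: "\<And>p. f (arm_point a b c p) = (if R_inverse (arm_point a b c p) = 0 then Infty
      else Fin (e + s / R_inverse (arm_point a b c p)))"
    and diff: "\<And>p. \<exists>D. has_differential a b c f p D"
  shows "critical_points a b c f = {X \<in> moduli a b c. signed_area X = 0}"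
proof -
  let ?W = "\<lambda>q. R_inverse (arm_point a b c q)"
  note W = R_inverse_has_derivative[OF pos]
  have key: "surj D \<longleftrightarrow> signed_area (arm_point a b c p) \<noteq> 0"
    if "has_differential a b c f p D" for p D
  proof -
    from that consider
      (affine) "\<forall>\<^sub>F q in nhds p. f (arm_point a b c q) \<noteq> Infty"
        "((\<lambda>q. affine_chart (f (arm_point a b c q))) has_derivative D) (at p)"
    | (infinity) "\<forall>\<^sub>F q in nhds p. f (arm_point a b c q) \<noteq> Fin 0"
        "((\<lambda>q. infinity_chart (f (arm_point a b c q))) has_derivative D) (at p)"
      by (auto simp: has_differential_def cp1_charts_def)
    then have "surj D \<longleftrightarrow> surj (R_inverse_differential a b c p)"
    proof cases
      case affine
      have nz: "?W p \<noteq> 0"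
        using eventually_nhds_x_imp_x[OF affine(1)] by (auto simp: f)
      show ?thesis
      proof (rule surj_differential_iff[OF W _ _ affine(2)])
        show "((\<lambda>w. e + s / w) has_field_derivative - s / (?W p)\<^sup>2) (at (?W p))"
          using nz by (auto intro!: derivative_eq_intros simp: power2_eq_square)
        show "- s / (?W p)\<^sup>2 \<noteq> 0" using nz s by simp
        show "\<forall>\<^sub>F q in nhds p. affine_chart (f (arm_point a b c q)) = e + s / ?W q"
          using affine(1) by eventually_elim (auto simp: f split: if_splits)
      qed
    next
      case infinity
      have nz: "e * ?W p + s \<noteq> 0"
        using eventually_nhds_x_imp_x[OF infinity(1)] s by (auto simp: f field_simps split: if_splits)
      show ?thesis
      proof (rule surj_differential_iff[OF W _ _ infinity(2)])
        show "((\<lambda>w. w / (e * w + s)) has_field_derivative s / (e * ?W p + s)\<^sup>2) (at (?W p))"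
          using nz by (auto intro!: derivative_eq_intros simp: power2_eq_square algebra_simps)
        show "s / (e * ?W p + s)\<^sup>2 \<noteq> 0" using nz s by simp
        show "\<forall>\<^sub>F q in nhds p. infinity_chart (f (arm_point a b c q)) = ?W q / (e * ?W q + s)"
          by (rule always_eventually) (auto simp: f divide_simps)
      qed
    qed
    then show ?thesis using surj_R_inverse_differential_iff[OF pos] by simp
  qed
  show ?thesis
  proof (intro equalityI subsetI)
    fix X assume "X \<in> critical_points a b c f"
    then show "X \<in> {X \<in> moduli a b c. signed_area X = 0}"
      using key by (auto simp: critical_points_def)
  next
    fix X assume X: "X \<in> {X \<in> moduli a b c. signed_area X = 0}"
    then obtain p where p: "X = arm_point a b c p"
      using moduli_eq_range_arm_point[OF pos] by auto
    obtain D where "has_differential a b c f p D" using diff by blast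
    moreover from this have "\<not> surj D"
      using X p key by simp
    ultimately show "X \<in> critical_points a b c f"
      using X p unfolding critical_points_def by blast
  qed
qed

lemma R_arm_point:
  assumes "a > 0" "b > 0" "c > 0"
  shows "R (arm_point a b c p) = (if R_inverse (arm_point a b c p) = 0 then Infty
      else Fin (0 + 1 / R_inverse (arm_point a b c p)))"
proof -
  note V = arm_configuration_in[OF assms, of p]
  have "R (arm_point a b c p) \<noteq> Fin 0"
    using R_conf_nonzero[OF assms V] by (simp add: arm_point_def R_class[OF V])
  then show ?thesis
    by (cases "R (arm_point a b c p)") (auto simp: R_inverse_def inverse_eq_divide)
qed

lemma Cr_arm_point:
  assumes "a > 0" "b > 0" "c > 0"
  shows "Cr (arm_point a b c p) = (if R_inverse (arm_point a b c p) = 0 then Infty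
      else Fin (1 + (- 1) / R_inverse (arm_point a b c p)))"
proof -
  note V = arm_configuration_in[OF assms, of p]
  have "Cr (arm_point a b c p) =
      (case R (arm_point a b c p) of Fin z \<Rightarrow> Fin (1 - z) | Infty \<Rightarrow> Infty)"
    using Cr_conf_eq[OF assms V] by (simp add: arm_point_def R_class[OF V] Cr_class[OF V])
  then show ?thesis by (simp add: R_arm_point[OF assms])
qed

theorem proposition4p2:
  fixes a b c :: real
  assumes "a > 0" and "b > 0" and "c > 0"
  shows "(\<exists>k. k \<noteq> 0 \<and>
           (\<forall>p. R_inverse_coord a b c differentiable (at p) \<and>
                det (jacobian (R_inverse_coord a b c) (at p)) = k * signed_area (arm_point a b c p)))
       \<and> critical_points a b c R = {X \<in> moduli a b c. signed_area X = 0}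
       \<and> critical_points a b c Cr = {X \<in> moduli a b c. signed_area X = 0}"
proof (intro conjI exI allI)
  show "2 * b\<^sup>2 / (a * c)\<^sup>2 \<noteq> 0" using assms by simp
  show "R_inverse_coord a b c differentiable (at p)" for p
    using R_inverse_coord_has_derivative[OF assms] by (auto simp: differentiable_def)
  show "det (jacobian (R_inverse_coord a b c) (at p)) =
      2 * b\<^sup>2 / (a * c)\<^sup>2 * signed_area (arm_point a b c p)" for p
    by (rule det_jacobian_R_inverse_coord[OF assms])
  show "critical_points a b c R = {X \<in> moduli a b c. signed_area X = 0}"
    by (rule critical_points_Moebius[OF assms _ R_arm_point[OF assms] R_has_differential[OF assms]]) simp
  show "critical_points a b c Cr = {X \<in> moduli a b c. signed_area X = 0}"
    by (rule critical_points_Moebius[OF assms _ Cr_arm_point[OF assms] Cr_has_differential[OF assms]]) simp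
qed

end
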